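(* Let $\alpha>0$, $\beta\ge0$, and suppose that $S:U\to Y$ satisfies the two assumptions stated in the context (weak-to-weak continuity and twice Fréchet differentiability). Let $\bar u\in U$ be a local minimizer (with respect to the $L^2(\Omega)$ norm) of $$\min_{u\in L^2(\Omega)}\ \mathcal{F}(u)+\mathcal{G}(u),\qquad \mathcal{F}(u)=\tfrac12\|S(u)-z\|_Y^2,\quad \mathcal{G}=\mathcal{G}_0^{**}.$$ Then there exists $\bar p\in L^2(\Omega)$ satisfying $$-\bar p=S'(\bar u)^*(S(\bar u)-z),\qquad \bar u\in\partial\mathcal{G}^*(\bar p).$$
   Context: $\Omega\subset\mathbb{R}^N$ is a bounded domain, $d\ge 2$, and $u_1<u_2<\dots<u_d$ are given real numbers. The admissible set is $U=\{u\in L^2(\Omega): u(x)\in[u_1,u_d]\text{ for almost all }x\in\Omega\}$. $Y$ is a Hilbert space, $z\in Y$ is given, and $S:U\to Y$ is a (generally nonlinear) mapping. Assumptions on $S$: (i) $S$ is weak-to-weak continuous, i.e. if $\{u_n\}_{n\in\mathbb{N}}\subset U$ and $u_n\rightharpoonup u\in U$ weakly in $L^2(\Omega)$, then $S(u_n)\rightharpoonup S(u)$ weakly in $Y$; (ii) $S$ is twice Fréchet differentiable on $U$. For $\alpha>0$, $\beta\ge0$ define $\mathcal{G}_0:L^2(\Omega)\to\mathbb{R}\cup\{+\infty\}$ by $$\mathcal{G}_0(u)=\tfrac\alpha2\|u\|_{L^2(\Omega)}^2+\beta\int_\Omega\prod_{i=1}^d|u(x)-u_i|^0\,dx+\delta_U(u),$$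 where $|0|^0=0$, $|t|^0=1$ for $t\ne0$, and $\delta_U(u)=0$ if $u\in U$, $\delta_U(u)=+\infty$ otherwise. $\mathcal{G}_0^*(q)=\sup_{u\in L^2(\Omega)}\langle q,u\rangle-\mathcal{G}_0(u)$ is the Fenchel conjugate on $L^2(\Omega)$ (identified with its dual), $\mathcal{G}:=\mathcal{G}_0^{**}=(\mathcal{G}_0^* )^*$ is the biconjugate, which equals $+\infty$ outside $U$ (so that the sum $\mathcal{F}+\mathcal{G}$ is $+\infty$ outside $U$), $\mathcal{G}^*$ is the Fenchel conjugate of $\mathcal{G}$, and $\partial$ denotes the convex subdifferential. $S'(\bar u)^*:Y\to L^2(\Omega)$ is the Hilbert space adjoint of $S'(\bar u)$. Fréchet differentiability on $U$ is understood relative to $U$: for each $\bar u\in U$ there is a bounded linear $S'(\bar u):L^2(\Omega)\to Y$ with $S(u)=S(\bar u)+S'(\bar u)(u-\bar u)+o(\|u-\bar u\|_{L^2(\Omega)})$ as $u\to\bar u$, $u\in U$, and analogously for the second derivative. *)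

theory Defs
  imports "HOL-Analysis.Analysis"
begin

text \<open>
  The space \<open>L\<^sup>2(M)\<close> is represented by the set of its representatives, square-integrable
  measurable functions; equality in \<open>L\<^sup>2(M)\<close> is equality almost everywhere, and \<open>l2_norm\<close> is
  only a seminorm on representatives. All notions below are invariant under changes on null sets.
\<close>

definition L2 :: "'a measure \<Rightarrow> ('a \<Rightarrow> real) set" where
  "L2 M = {f. f \<in> borel_measurable M \<and> integrable M (\<lambda>x. (f x)\<^sup>2)}"

definition l2_inner :: "'a measure \<Rightarrow> ('a \<Rightarrow> real) \<Rightarrow> ('a \<Rightarrow> real) \<Rightarrow> real" where
  "l2_inner M f g = (LINT x|M. f x * g x)"

definition l2_norm :: "'a measure \<Rightarrow> ('a \<Rightarrow> real) \<Rightarrow> real" where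
  "l2_norm M f = sqrt (l2_inner M f f)"

definition l2_weakly_tendsto ::
    "'a measure \<Rightarrow> (nat \<Rightarrow> 'a \<Rightarrow> real) \<Rightarrow> ('a \<Rightarrow> real) \<Rightarrow> bool" where
  "l2_weakly_tendsto M f g \<longleftrightarrow>
     (\<forall>\<phi>\<in>L2 M. (\<lambda>n. l2_inner M \<phi> (f n)) \<longlonglongrightarrow> l2_inner M \<phi> g)"

definition weakly_tendsto :: "(nat \<Rightarrow> 'y::real_inner) \<Rightarrow> 'y \<Rightarrow> bool" where
  "weakly_tendsto f g \<longleftrightarrow> (\<forall>y. (\<lambda>n. y \<bullet> f n) \<longlonglongrightarrow> y \<bullet> g)"

definition weak_to_weak_continuous_on ::
    "'a measure \<Rightarrow> ('a \<Rightarrow> real) set \<Rightarrow> (('a \<Rightarrow> real) \<Rightarrow> 'y::real_inner) \<Rightarrow> bool" where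
  "weak_to_weak_continuous_on M U S \<longleftrightarrow>
     (\<forall>f g. (\<forall>n. f n \<in> U) \<and> g \<in> U \<and> l2_weakly_tendsto M f g
        \<longrightarrow> weakly_tendsto (\<lambda>n. S (f n)) (S g))"

text \<open>
  Weak-to-weak continuity of a map on representatives already forces it to be well defined on
  \<open>L\<^sup>2(M)\<close>, so this needs no separate hypothesis.
\<close>

lemma weak_to_weak_continuous_on_AE_cong:
  assumes S: "weak_to_weak_continuous_on M U S" and U: "U \<subseteq> L2 M"
    and fg: "f \<in> U" "g \<in> U" "AE x in M. f x = g x"
  shows "S f = S g"
proof -
  have "l2_inner M \<phi> f = l2_inner M \<phi> g" if "\<phi> \<in> L2 M" for \<phi>
    unfolding l2_inner_def
  proof (rule integral_cong_AE)
    have [measurable]: "\<phi> \<in> borel_measurable M" "f \<in> borel_measurable M" "g \<in> borel_measurable M"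
      using that U fg(1,2) by (auto simp: L2_def)
    show "(\<lambda>x. \<phi> x * f x) \<in> borel_measurable M" "(\<lambda>x. \<phi> x * g x) \<in> borel_measurable M"
      by measurable
    show "AE x in M. \<phi> x * f x = \<phi> x * g x"
      using fg(3) by eventually_elim simp
  qed
  then have "l2_weakly_tendsto M (\<lambda>_. f) g"
    by (simp add: l2_weakly_tendsto_def)
  then have "weakly_tendsto (\<lambda>_. S f) (S g)"
    using S[unfolded weak_to_weak_continuous_on_def, rule_format, of "\<lambda>_. f" g] fg by simp
  then show ?thesis
    by (simp add: weakly_tendsto_def LIMSEQ_const_iff vector_eq_ldot)
qed

definition l2_bounded_linear ::
    "'a measure \<Rightarrow> (('a \<Rightarrow> real) \<Rightarrow> 'y::real_normed_vector) \<Rightarrow> bool" where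
  "l2_bounded_linear M T \<longleftrightarrow>
     (\<forall>f\<in>L2 M. \<forall>g\<in>L2 M. T (\<lambda>x. f x + g x) = T f + T g) \<and>
     (\<forall>c. \<forall>f\<in>L2 M. T (\<lambda>x. c * f x) = c *\<^sub>R T f) \<and>
     (\<exists>C. \<forall>f\<in>L2 M. norm (T f) \<le> C * l2_norm M f)"

text \<open>The Hilbert space adjoint; its values are determined up to equality almost everywhere.\<close>

definition l2_adjoint ::
    "'a measure \<Rightarrow> (('a \<Rightarrow> real) \<Rightarrow> 'y::real_inner) \<Rightarrow> 'y \<Rightarrow> 'a \<Rightarrow> real" where
  "l2_adjoint M T =
     (SOME T'. \<forall>y. T' y \<in> L2 M \<and> (\<forall>h\<in>L2 M. T h \<bullet> y = l2_inner M h (T' y)))"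

definition has_l2_derivative ::
    "'a measure \<Rightarrow> ('a \<Rightarrow> real) set \<Rightarrow> (('a \<Rightarrow> real) \<Rightarrow> 'y::real_normed_vector) \<Rightarrow>
     (('a \<Rightarrow> real) \<Rightarrow> 'y) \<Rightarrow> ('a \<Rightarrow> real) \<Rightarrow> bool" where
  "has_l2_derivative M U S D v \<longleftrightarrow>
     l2_bounded_linear M D \<and>
     (\<forall>\<epsilon>>0. \<exists>\<delta>>0. \<forall>u\<in>U. l2_norm M (\<lambda>x. u x - v x) < \<delta> \<longrightarrow>
        norm (S u - S v - D (\<lambda>x. u x - v x)) \<le> \<epsilon> * l2_norm M (\<lambda>x. u x - v x))"

text \<open>
  \<open>B\<close> is the derivative relative to \<open>U\<close> at \<open>v\<close> of the operator-valued map \<open>S'\<close>, that is, a bounded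
  linear map from \<open>L\<^sup>2(M)\<close> into the bounded linear operators from \<open>L\<^sup>2(M)\<close> to \<open>Y\<close>. Inequalities
  \<open>\<parallel>T\<parallel> \<le> c\<close> for the operator norm are written as \<open>norm (T k) \<le> c * l2_norm M k\<close> for all \<open>k\<close>.
\<close>

definition has_l2_derivative_op ::
    "'a measure \<Rightarrow> ('a \<Rightarrow> real) set \<Rightarrow>
     (('a \<Rightarrow> real) \<Rightarrow> ('a \<Rightarrow> real) \<Rightarrow> 'y::real_normed_vector) \<Rightarrow>
     (('a \<Rightarrow> real) \<Rightarrow> ('a \<Rightarrow> real) \<Rightarrow> 'y) \<Rightarrow> ('a \<Rightarrow> real) \<Rightarrow> bool" where
  "has_l2_derivative_op M U S' B v \<longleftrightarrow>
     (\<forall>h\<in>L2 M. l2_bounded_linear M (B h)) \<and>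
     (\<forall>f\<in>L2 M. \<forall>g\<in>L2 M. \<forall>k\<in>L2 M. B (\<lambda>x. f x + g x) k = B f k + B g k) \<and>
     (\<forall>c. \<forall>f\<in>L2 M. \<forall>k\<in>L2 M. B (\<lambda>x. c * f x) k = c *\<^sub>R B f k) \<and>
     (\<exists>C. \<forall>h\<in>L2 M. \<forall>k\<in>L2 M. norm (B h k) \<le> C * l2_norm M h * l2_norm M k) \<and>
     (\<forall>\<epsilon>>0. \<exists>\<delta>>0. \<forall>u\<in>U. l2_norm M (\<lambda>x. u x - v x) < \<delta> \<longrightarrow>
        (\<forall>k\<in>L2 M. norm (S' u k - S' v k - B (\<lambda>x. u x - v x) k)
           \<le> \<epsilon> * l2_norm M (\<lambda>x. u x - v x) * l2_norm M k))"

definition l2_conjugate ::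
    "'a measure \<Rightarrow> (('a \<Rightarrow> real) \<Rightarrow> ereal) \<Rightarrow> ('a \<Rightarrow> real) \<Rightarrow> ereal" where
  "l2_conjugate M G q = (SUP u\<in>L2 M. ereal (l2_inner M q u) - G u)"

definition l2_subdifferential ::
    "'a measure \<Rightarrow> (('a \<Rightarrow> real) \<Rightarrow> ereal) \<Rightarrow> ('a \<Rightarrow> real) \<Rightarrow> ('a \<Rightarrow> real) set" where
  "l2_subdifferential M G p =
     {u \<in> L2 M. \<bar>G p\<bar> \<noteq> \<infinity> \<and>
        (\<forall>q\<in>L2 M. G p + ereal (l2_inner M u (\<lambda>x. q x - p x)) \<le> G q)}"

text \<open>The parameters \<open>u\<^sub>1 < \<dots> < u\<^sub>d\<close> are the values \<open>a 1, \<dots>, a d\<close> of a sequence \<open>a\<close>.\<close>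

definition admissible :: "'a measure \<Rightarrow> nat \<Rightarrow> (nat \<Rightarrow> real) \<Rightarrow> ('a \<Rightarrow> real) set" where
  "admissible M d a = {u \<in> L2 M. AE x in M. u x \<in> {a 1..a d}}"

text \<open>\<open>abs_pow0 t\<close> is \<open>|t|\<^sup>0\<close> with the convention \<open>|0|\<^sup>0 = 0\<close>, unlike \<open>0 ^ 0 = 1\<close>.\<close>

definition abs_pow0 :: "real \<Rightarrow> real" where
  "abs_pow0 t = (if t = 0 then 0 else 1)"

definition G0 ::
    "'a measure \<Rightarrow> real \<Rightarrow> real \<Rightarrow> nat \<Rightarrow> (nat \<Rightarrow> real) \<Rightarrow> ('a \<Rightarrow> real) \<Rightarrow> ereal" where
  "G0 M \<alpha> \<beta> d a u =
     ereal (\<alpha> / 2 * (l2_norm M u)\<^sup>2 + \<beta> * (LINT x|M. (\<Prod>i=1..d. abs_pow0 (u x - a i))))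
     + (if u \<in> admissible M d a then 0 else \<infinity>)"

definition G ::
    "'a measure \<Rightarrow> real \<Rightarrow> real \<Rightarrow> nat \<Rightarrow> (nat \<Rightarrow> real) \<Rightarrow> ('a \<Rightarrow> real) \<Rightarrow> ereal" where
  "G M \<alpha> \<beta> d a = l2_conjugate M (l2_conjugate M (G0 M \<alpha> \<beta> d a))"

text \<open>
  \<open>S\<close> is a total function in HOL, but its values outside the admissible set are irrelevant when
  \<open>tracking S z\<close> is added to \<open>G\<close>, which is infinite there.
\<close>

definition tracking :: "(('a \<Rightarrow> real) \<Rightarrow> 'y::real_inner) \<Rightarrow> 'y \<Rightarrow> ('a \<Rightarrow> real) \<Rightarrow> real" where
  "tracking S z u = 1 / 2 * (norm (S u - z))\<^sup>2"

definition l2_local_minimizer ::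
    "'a measure \<Rightarrow> (('a \<Rightarrow> real) \<Rightarrow> ereal) \<Rightarrow> ('a \<Rightarrow> real) \<Rightarrow> bool" where
  "l2_local_minimizer M J v \<longleftrightarrow>
     v \<in> L2 M \<and> (\<exists>r>0. \<forall>u\<in>L2 M. l2_norm M (\<lambda>x. u x - v x) < r \<longrightarrow> J v \<le> J u)"

end

theory Submission imports Defs begin

text \<open>
  Write \<open>F u = 1/2 \<parallel>S u - z\<parallel>\<^sup>2\<close>, \<open>U\<close> for the admissible set and \<open>D = S' ubar\<close>. Since \<open>F\<close>
  has the derivative \<open>h \<mapsto> D h \<bullet> (S ubar - z)\<close> at \<open>ubar\<close> relative to \<open>U\<close>, and \<open>G\<close> is convex,
  the condition to be shown is Fermat's rule \<open>p \<in> \<partial>G ubar\<close> for \<open>p = - D\<^sup>* (S ubar - z)\<close>,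
  restated as \<open>ubar \<in> \<partial>G\<^sup>* p\<close>.

  The derivative is only taken within \<open>U\<close>, so the subgradient inequality at a competitor \<open>v\<close>
  splits into two cases. If \<open>v\<close> is admissible, the segment from \<open>ubar\<close> to \<open>v\<close> stays in the
  convex set \<open>U\<close> and \<open>G\<close> is finite at both ends (\<open>G_finite_on_admissible\<close>); comparing
  \<open>F + G\<close> at \<open>ubar\<close> with its values along the segment and letting the step tend to zero
  gives the inequality (\<open>local_minimizer_variational_inequality\<close>). If \<open>v\<close> is not admissible,
  then \<open>G v = \<infinity>\<close> (\<open>G_infinite_off_admissible\<close>): forming the biconjugate does not enlarge
  the domain, because \<open>U\<close> is closed and convex.

  The passage from \<open>\<partial>G\<close> to \<open>\<partial>G\<^sup>*\<close> is the Fenchel--Young argument of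
  \<open>l2_subdifferential_conjugateI\<close>. The adjoint exists by the Riesz representation theorem,
  which in turn rests on the completeness of \<open>L\<^sup>2\<close>; both are proved here for square-integrable
  representatives (\<open>L2_complete_rapidly_Cauchy\<close>, \<open>L2_Riesz_representation\<close>).
\<close>

section \<open>The space of square-integrable functions\<close>

lemma L2_measurable: "f \<in> L2 M \<Longrightarrow> f \<in> borel_measurable M"
  by (simp add: L2_def)

lemma integrable_mult_L2:
  assumes "f \<in> L2 M" "g \<in> L2 M"
  shows "integrable M (\<lambda>x. f x * g x)"
proof (rule Bochner_Integration.integrable_bound)
  have [measurable]: "f \<in> borel_measurable M" "g \<in> borel_measurable M"
    using assms by (auto simp: L2_def)
  show "(\<lambda>x. f x * g x) \<in> borel_measurable M"
    by measurable
  show "integrable M (\<lambda>x. (f x)\<^sup>2 + (g x)\<^sup>2)"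
    using assms by (auto simp: L2_def)
  show "AE x in M. norm (f x * g x) \<le> norm ((f x)\<^sup>2 + (g x)\<^sup>2)"
  proof (rule AE_I2)
    fix x
    have "2 * \<bar>f x\<bar> * \<bar>g x\<bar> \<le> (f x)\<^sup>2 + (g x)\<^sup>2"
      using sum_squares_bound[of "\<bar>f x\<bar>" "\<bar>g x\<bar>"] by simp
    moreover have "0 \<le> \<bar>f x\<bar> * \<bar>g x\<bar>"
      by simp
    ultimately have "\<bar>f x\<bar> * \<bar>g x\<bar> \<le> (f x)\<^sup>2 + (g x)\<^sup>2"
      by linarith
    then show "norm (f x * g x) \<le> norm ((f x)\<^sup>2 + (g x)\<^sup>2)"
      by (simp add: abs_mult)
  qed
qed

lemma L2_lincomb:
  assumes "f \<in> L2 M" "g \<in> L2 M"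
  shows "(\<lambda>x. b * f x + c * g x) \<in> L2 M"
proof -
  have [measurable]: "f \<in> borel_measurable M" "g \<in> borel_measurable M"
    using assms by (auto simp: L2_def)
  have "(\<lambda>x. (b * f x + c * g x)\<^sup>2)
      = (\<lambda>x. b\<^sup>2 * (f x)\<^sup>2 + (2 * b * c) * (f x * g x) + c\<^sup>2 * (g x)\<^sup>2)"
    by (auto simp: power2_eq_square algebra_simps)
  moreover have "integrable M \<dots>"
    using assms integrable_mult_L2[OF assms] by (auto simp: L2_def)
  ultimately show ?thesis
    by (simp add: L2_def)
qed

lemma L2_cmult: "f \<in> L2 M \<Longrightarrow> (\<lambda>x. c * f x) \<in> L2 M"
  using L2_lincomb[of f M f c 0] by simp

lemma L2_diff: "f \<in> L2 M \<Longrightarrow> g \<in> L2 M \<Longrightarrow> (\<lambda>x. f x - g x) \<in> L2 M"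
  using L2_lincomb[of f M g 1 "-1"] by simp

lemma l2_inner_commute: "l2_inner M f g = l2_inner M g f"
  by (simp add: l2_inner_def mult.commute)

lemma l2_inner_lincomb_left:
  assumes "f \<in> L2 M" "g \<in> L2 M" "h \<in> L2 M"
  shows "l2_inner M (\<lambda>x. b * f x + c * g x) h = b * l2_inner M f h + c * l2_inner M g h"
proof -
  have "(\<lambda>x. (b * f x + c * g x) * h x) = (\<lambda>x. b * (f x * h x) + c * (g x * h x))"
    by (auto simp: algebra_simps)
  then show ?thesis
    using integrable_mult_L2[OF assms(1,3)] integrable_mult_L2[OF assms(2,3)]
    by (simp add: l2_inner_def)
qed

lemma l2_inner_diff_left:
  assumes "f \<in> L2 M" "g \<in> L2 M" "h \<in> L2 M"
  shows "l2_inner M (\<lambda>x. f x - g x) h = l2_inner M f h - l2_inner M g h"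
  using l2_inner_lincomb_left[OF assms, of 1 "-1"] by simp

lemma l2_inner_cmult_left: "l2_inner M (\<lambda>x. c * f x) h = c * l2_inner M f h"
  by (simp add: l2_inner_def mult.assoc)

lemma l2_inner_lincomb_self:
  assumes "f \<in> L2 M" "g \<in> L2 M"
  shows "l2_inner M (\<lambda>x. b * f x + c * g x) (\<lambda>x. b * f x + c * g x)
    = b\<^sup>2 * l2_inner M f f + 2 * b * c * l2_inner M f g + c\<^sup>2 * l2_inner M g g"
proof -
  have "l2_inner M f (\<lambda>x. b * f x + c * g x) = b * l2_inner M f f + c * l2_inner M f g"
    "l2_inner M g (\<lambda>x. b * f x + c * g x) = b * l2_inner M f g + c * l2_inner M g g"
    using assms by (simp_all add: l2_inner_commute[of M _ "\<lambda>x. b * f x + c * g x"]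
        l2_inner_lincomb_left l2_inner_commute[of M g f])
  then show ?thesis
    using assms by (simp add: l2_inner_lincomb_left L2_lincomb power2_eq_square algebra_simps)
qed

lemma l2_inner_self_nonneg: "0 \<le> l2_inner M f f"
  by (simp add: l2_inner_def)

lemma l2_norm_nonneg: "0 \<le> l2_norm M f"
  by (simp add: l2_norm_def l2_inner_self_nonneg)

lemma l2_norm_squared: "(l2_norm M f)\<^sup>2 = l2_inner M f f"
  by (simp add: l2_norm_def l2_inner_self_nonneg)

lemma l2_norm_cmult: "l2_norm M (\<lambda>x. c * f x) = \<bar>c\<bar> * l2_norm M f"
proof -
  have "l2_inner M (\<lambda>x. c * f x) (\<lambda>x. c * f x) = c\<^sup>2 * l2_inner M f f"
    by (simp add: l2_inner_cmult_left l2_inner_commute[of M _ "\<lambda>x. c * f x"] power2_eq_square)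
  then show ?thesis
    by (simp add: l2_norm_def real_sqrt_mult)
qed

text \<open>
  The squared differences control the sum of the differences themselves, because
  \<open>\<bar>t\<bar> \<le> 2\<^sup>-\<^sup>n + 2\<^sup>n t\<^sup>2\<close> and the integrals of \<open>2\<^sup>n (f (Suc n) - f n)\<^sup>2\<close> are summable.
  Hence the sequence converges almost everywhere, and Fatou's lemma carries the bounds on
  \<open>f m - f n\<close> over to the limit \<open>m \<rightarrow> \<infinity>\<close>. The rate \<open>4\<^sup>-\<^sup>n\<close> is what a minimizing
  sequence can be chosen to have.
\<close>

lemma L2_complete_rapidly_Cauchy:
  assumes f: "\<And>n. f n \<in> L2 M"
    and C: "\<And>m n. n \<le> m \<Longrightarrow> l2_inner M (\<lambda>x. f m x - f n x) (\<lambda>x. f m x - f n x) \<le> C / 4 ^ n"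
  shows "\<exists>g\<in>L2 M. \<forall>n. l2_inner M (\<lambda>x. g x - f n x) (\<lambda>x. g x - f n x) \<le> C / 4 ^ n"
proof -
  have [measurable]: "f n \<in> borel_measurable M" for n
    using f by (rule L2_measurable)
  have C0: "0 \<le> C"
    using C[of 0 0] by (simp add: l2_inner_def)
  have nn: "(\<integral>\<^sup>+x. ennreal ((f m x - f n x)\<^sup>2) \<partial>M) \<le> ennreal (C / 4 ^ n)" if "n \<le> m" for m n
  proof -
    have "(\<integral>\<^sup>+x. ennreal ((f m x - f n x)\<^sup>2) \<partial>M) = ennreal (LINT x|M. (f m x - f n x)\<^sup>2)"
      using L2_diff[OF f f, of m n] by (intro nn_integral_eq_integral) (auto simp: L2_def)
    also have "\<dots> \<le> ennreal (C / 4 ^ n)"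
      using C[OF that] by (intro ennreal_leI) (simp add: l2_inner_def power2_eq_square)
    finally show ?thesis .
  qed
  let ?w = "\<lambda>n x. 2 ^ n * (f (Suc n) x - f n x)\<^sup>2"
  have w: "(\<integral>\<^sup>+x. ennreal (?w n x) \<partial>M) \<le> ennreal (C * (1/2) ^ n)" for n
  proof -
    have "(\<integral>\<^sup>+x. ennreal (?w n x) \<partial>M)
        = ennreal (2 ^ n) * (\<integral>\<^sup>+x. ennreal ((f (Suc n) x - f n x)\<^sup>2) \<partial>M)"
      by (simp add: ennreal_mult nn_integral_cmult)
    also have "\<dots> \<le> ennreal (2 ^ n) * ennreal (C / 4 ^ n)"
      by (intro mult_left_mono nn) auto
    also have "\<dots> = ennreal (2 ^ n * (C / 4 ^ n))"
      using C0 by (intro ennreal_mult[symmetric]) auto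
    also have "2 ^ n * (C / 4 ^ n) = C * (1/2) ^ n"
      using power_mult_distrib[of "2::real" 2 n] by (simp add: power_one_over field_simps)
    finally show ?thesis .
  qed
  have "(\<integral>\<^sup>+x. (\<Sum>n. ennreal (?w n x)) \<partial>M) = (\<Sum>n. \<integral>\<^sup>+x. ennreal (?w n x) \<partial>M)"
    by (rule nn_integral_suminf) simp
  also have "\<dots> \<le> (\<Sum>n. ennreal (C * (1/2) ^ n))"
    by (intro suminf_le w) auto
  also have "\<dots> = ennreal (\<Sum>n. C * (1/2) ^ n)"
    using C0 by (intro suminf_ennreal2 summable_mult summable_geometric) auto
  also have "\<dots> < \<infinity>"
    by simp
  finally have "AE x in M. (\<Sum>n. ennreal (?w n x)) \<noteq> \<infinity>"
    by (intro nn_integral_noteq_infinite) auto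
  then have conv: "AE x in M. convergent (\<lambda>n. f n x)"
  proof eventually_elim
    case (elim x)
    have "summable (\<lambda>n. ?w n x)"
      using elim by (intro summable_suminf_not_top) auto
    then have "summable (\<lambda>n. (1/2) ^ n + ?w n x)"
      by (intro summable_add summable_geometric) auto
    then have "summable (\<lambda>n. f (Suc n) x - f n x)"
    proof (rule summable_comparison_test'[where N = 0])
      fix n
      let ?t = "\<bar>f (Suc n) x - f n x\<bar>"
      have "2 * ?t \<le> (1/2) ^ n + 2 ^ n * ?t\<^sup>2"
        using zero_le_power2[of "2 ^ n * ?t - 1"]
        by (simp add: power2_eq_square power_one_over field_simps)
      moreover have "?t \<le> 2 * ?t"
        by simp
      ultimately have "?t \<le> (1/2) ^ n + 2 ^ n * ?t\<^sup>2"
        by (rule order_trans[rotated])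
      then show "norm (f (Suc n) x - f n x) \<le> (1/2) ^ n + ?w n x"
        by simp
    qed
    then have "convergent (\<lambda>n. \<Sum>k<n. f (Suc k) x - f k x)"
      by (simp add: summable_iff_convergent)
    then have "convergent (\<lambda>n. f n x - f 0 x)"
      by (simp add: sum_lessThan_telescope[of "\<lambda>n. f n x"])
    then show ?case
      using convergent_add[of "\<lambda>n. f n x - f 0 x" "\<lambda>_. f 0 x"] by (simp add: convergent_const)
  qed
  define g where "g = (\<lambda>x. lim (\<lambda>n. f n x))"
  have [measurable]: "g \<in> borel_measurable M"
    unfolding g_def by measurable
  have lim: "AE x in M. (\<lambda>n. f n x) \<longlonglongrightarrow> g x"
    using conv by eventually_elim (simp add: g_def convergent_LIMSEQ_iff)
  have bound: "(\<integral>\<^sup>+x. ennreal ((g x - f n x)\<^sup>2) \<partial>M) \<le> ennreal (C / 4 ^ n)" for n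
  proof -
    have "(\<integral>\<^sup>+x. ennreal ((g x - f n x)\<^sup>2) \<partial>M)
        = (\<integral>\<^sup>+x. liminf (\<lambda>m. ennreal ((f m x - f n x)\<^sup>2)) \<partial>M)"
    proof (rule nn_integral_cong_AE)
      show "AE x in M. ennreal ((g x - f n x)\<^sup>2) = liminf (\<lambda>m. ennreal ((f m x - f n x)\<^sup>2))"
        using lim
      proof eventually_elim
        case (elim x)
        then have "(\<lambda>m. ennreal ((f m x - f n x)\<^sup>2)) \<longlonglongrightarrow> ennreal ((g x - f n x)\<^sup>2)"
          by (intro tendsto_ennrealI tendsto_intros)
        then show ?case
          by (rule lim_imp_Liminf[OF trivial_limit_sequentially, symmetric])
      qed
    qed
    also have "\<dots> \<le> liminf (\<lambda>m. \<integral>\<^sup>+x. ennreal ((f m x - f n x)\<^sup>2) \<partial>M)"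
      by (rule nn_integral_liminf) simp
    also have "\<dots> \<le> ennreal (C / 4 ^ n)"
      by (rule Liminf_le) (auto simp: eventually_sequentially intro!: exI[of _ n] nn)
    finally show ?thesis .
  qed
  have diff: "(\<lambda>x. g x - f n x) \<in> L2 M" for n
  proof -
    have "integrable M (\<lambda>x. (g x - f n x)\<^sup>2)"
      using bound[of n] by (intro integrableI_bounded) (auto simp: less_top[symmetric] top_unique)
    then show ?thesis
      by (simp add: L2_def)
  qed
  have "l2_inner M (\<lambda>x. g x - f n x) (\<lambda>x. g x - f n x) \<le> C / 4 ^ n" for n
  proof -
    have "ennreal (LINT x|M. (g x - f n x)\<^sup>2) = (\<integral>\<^sup>+x. ennreal ((g x - f n x)\<^sup>2) \<partial>M)"
      using diff[of n] by (intro nn_integral_eq_integral[symmetric]) (auto simp: L2_def)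
    then have "ennreal (LINT x|M. (g x - f n x)\<^sup>2) \<le> ennreal (C / 4 ^ n)"
      using bound[of n] by simp
    then show ?thesis
      using C0 by (simp add: l2_inner_def power2_eq_square)
  qed
  moreover have "g \<in> L2 M"
    using L2_lincomb[OF diff[of 0] f[of 0], of 1 1] by simp
  ultimately show ?thesis
    by blast
qed

text \<open>
  The representing function minimizes the quadratic functional \<open>J h = \<parallel>h\<parallel>\<^sup>2 - 2 \<phi> h\<close>. By the
  parallelogram law, approximate minimizers are close to each other, so a minimizing sequence
  converges; the vanishing first variation at the limit is the representation.
\<close>

lemma L2_Riesz_representation:
  assumes add: "\<And>f g. f \<in> L2 M \<Longrightarrow> g \<in> L2 M \<Longrightarrow> \<phi> (\<lambda>x. f x + g x) = \<phi> f + \<phi> g"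
    and scale: "\<And>c f. f \<in> L2 M \<Longrightarrow> \<phi> (\<lambda>x. c * f x) = c * \<phi> f"
    and bounded: "\<And>f. f \<in> L2 M \<Longrightarrow> \<bar>\<phi> f\<bar> \<le> C * l2_norm M f"
  shows "\<exists>g\<in>L2 M. \<forall>h\<in>L2 M. \<phi> h = l2_inner M h g"
proof -
  define J where "J h = l2_inner M h h - 2 * \<phi> h" for h
  have lin: "\<phi> (\<lambda>x. b * f x + c * g x) = b * \<phi> f + c * \<phi> g" if "f \<in> L2 M" "g \<in> L2 M" for f g b c
    using that by (simp add: add scale L2_cmult)
  have below: "- C\<^sup>2 \<le> J h" if "h \<in> L2 M" for h
  proof -
    have "\<phi> h \<le> C * l2_norm M h"
      using bounded[OF that] by simp
    moreover have "2 * (C * l2_norm M h) \<le> (l2_norm M h)\<^sup>2 + C\<^sup>2"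
      using sum_squares_bound[of C "l2_norm M h"] by simp
    ultimately show ?thesis
      by (simp add: J_def l2_norm_squared[symmetric])
  qed
  define m where "m = (INF h\<in>L2 M. J h)"
  have zero: "(\<lambda>_. 0) \<in> L2 M"
    by (simp add: L2_def)
  have bdd: "bdd_below (J ` L2 M)"
    using below by (auto simp: bdd_below_def)
  have m: "m \<le> J h" if "h \<in> L2 M" for h
    unfolding m_def using that bdd by (rule cINF_lower[rotated])
  have "\<exists>h\<in>L2 M. J h < m + 1 / 4 ^ n" for n :: nat
    using zero bdd cINF_less_iff[of "L2 M" J "m + 1 / 4 ^ n"] by (auto simp: m_def)
  then obtain f where f: "\<And>n::nat. f n \<in> L2 M" "\<And>n. J (f n) < m + 1 / 4 ^ n"
    by metis
  have "l2_inner M (\<lambda>x. f k x - f n x) (\<lambda>x. f k x - f n x) \<le> 4 / 4 ^ n" if "n \<le> k" for k n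
  proof -
    define h where "h = (\<lambda>x. 1/2 * f k x + 1/2 * f n x)"
    define K where "K = l2_inner M (\<lambda>x. f k x - f n x) (\<lambda>x. f k x - f n x)"
    define e :: real where "e = 1 / 4 ^ n"
    have "l2_inner M h h = 1/4 * l2_inner M (f k) (f k) + 1/2 * l2_inner M (f k) (f n)
        + 1/4 * l2_inner M (f n) (f n)"
      unfolding h_def l2_inner_lincomb_self[OF f(1) f(1)] by (simp add: power2_eq_square)
    moreover have "K = l2_inner M (f k) (f k) - 2 * l2_inner M (f k) (f n) + l2_inner M (f n) (f n)"
      using l2_inner_lincomb_self[OF f(1) f(1), of 1 k "-1" n] by (simp add: K_def)
    moreover have "\<phi> h = 1/2 * \<phi> (f k) + 1/2 * \<phi> (f n)"
      unfolding h_def by (rule lin[OF f(1) f(1)])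
    ultimately have "J h = (J (f k) + J (f n)) / 2 - K / 4"
      by (simp add: J_def field_simps)
    moreover have "m \<le> J h"
      unfolding h_def by (intro m L2_lincomb f)
    moreover have "(1::real) / 4 ^ k \<le> e"
      using that by (simp add: e_def frac_le power_increasing)
    then have "J (f k) < m + e" "J (f n) < m + e"
      using f(2)[of k] f(2)[of n] by (auto simp: e_def)
    ultimately have "K \<le> 4 * e"
      by argo
    then show ?thesis
      by (simp add: K_def e_def)
  qed
  then obtain g where g: "g \<in> L2 M"
      "\<And>n. l2_inner M (\<lambda>x. g x - f n x) (\<lambda>x. g x - f n x) \<le> 4 / 4 ^ n"
    using L2_complete_rapidly_Cauchy[of f M 4] f(1) by blast
  have "\<phi> h = l2_inner M h g" if h: "h \<in> L2 M" for h
  proof -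
    let ?K = "l2_inner M h h"
    let ?e = "\<lambda>n x. g x - f n x"
    have "(\<lambda>n. l2_inner M (?e n) h) \<longlonglongrightarrow> 0"
    proof (rule Lim_null_comparison)
      show "\<forall>\<^sub>F n in sequentially. norm (l2_inner M (?e n) h) \<le> (4 + ?K) * (1/2) ^ n"
      proof (rule always_eventually, rule allI)
        fix n :: nat
        have e: "?e n \<in> L2 M"
          by (intro L2_diff g f)
        \<comment> \<open>Young's inequality, weighted so that both squares contribute the same order.\<close>
        have "0 \<le> 4 ^ n * l2_inner M (?e n) (?e n) + 2 * 2 ^ n * l2_inner M (?e n) h + ?K"
          "0 \<le> 4 ^ n * l2_inner M (?e n) (?e n) - 2 * 2 ^ n * l2_inner M (?e n) h + ?K"
          using l2_inner_self_nonneg[of M "\<lambda>x. 2 ^ n * ?e n x + 1 * h x"]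
            l2_inner_self_nonneg[of M "\<lambda>x. 2 ^ n * ?e n x + (-1) * h x"]
            power_mult_distrib[of "2::real" 2 n]
          unfolding l2_inner_lincomb_self[OF e h]
          by (simp_all add: power2_eq_square)
        moreover have "4 ^ n * l2_inner M (?e n) (?e n) \<le> 4"
          using g(2)[of n] by (simp add: field_simps)
        ultimately have "2 * (2 ^ n * \<bar>l2_inner M (?e n) h\<bar>) \<le> 4 + ?K"
          by (cases "0 \<le> l2_inner M (?e n) h") auto
        moreover have "0 \<le> 2 ^ n * \<bar>l2_inner M (?e n) h\<bar>"
          by simp
        ultimately have "2 ^ n * \<bar>l2_inner M (?e n) h\<bar> \<le> 4 + ?K"
          by linarith
        then show "norm (l2_inner M (?e n) h) \<le> (4 + ?K) * (1/2) ^ n"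
          by (simp add: power_one_over field_simps)
      qed
      show "(\<lambda>n. (4 + ?K) * (1/2) ^ n) \<longlonglongrightarrow> 0"
        by (intro tendsto_mult_right_zero LIMSEQ_power_zero) simp
    qed
    then have "(\<lambda>n. l2_inner M g h - l2_inner M (f n) h) \<longlonglongrightarrow> 0"
      using g(1) f(1) h by (simp add: l2_inner_diff_left)
    then have "(\<lambda>n. l2_inner M g h - (l2_inner M g h - l2_inner M (f n) h)) \<longlonglongrightarrow> l2_inner M g h - 0"
      by (intro tendsto_diff tendsto_const)
    then have lim: "(\<lambda>n. l2_inner M (f n) h) \<longlonglongrightarrow> l2_inner M g h"
      by simp
    let ?b = "l2_inner M g h - \<phi> h"
    have variation: "0 \<le> 2 * t * ?b + t\<^sup>2 * ?K" for t
    proof -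
      have "0 \<le> 1 / 4 ^ n + 2 * t * (l2_inner M (f n) h - \<phi> h) + t\<^sup>2 * ?K" for n
      proof -
        have "J (\<lambda>x. 1 * f n x + t * h x)
            = J (f n) + 2 * t * (l2_inner M (f n) h - \<phi> h) + t\<^sup>2 * ?K"
          unfolding J_def l2_inner_lincomb_self[OF f(1) h] lin[OF f(1) h]
          by (simp add: algebra_simps)
        then show ?thesis
          using m[OF L2_lincomb[OF f(1)[of n] h, of 1 t]] f(2)[of n] by linarith
      qed
      moreover have "(\<lambda>n. 1 / 4 ^ n + 2 * t * (l2_inner M (f n) h - \<phi> h) + t\<^sup>2 * ?K)
          \<longlonglongrightarrow> 0 + 2 * t * ?b + t\<^sup>2 * ?K"
      proof (intro tendsto_intros lim)
        show "(\<lambda>n. 1 / 4 ^ n) \<longlonglongrightarrow> (0::real)"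
          using LIMSEQ_power_zero[of "1/4::real"] by (simp add: power_one_over)
      qed
      ultimately have "0 \<le> 0 + 2 * t * ?b + t\<^sup>2 * ?K"
        by (intro LIMSEQ_le_const) auto
      then show ?thesis
        by simp
    qed
    have K: "0 \<le> ?K"
      by (rule l2_inner_self_nonneg)
    have "?b = 0"
    proof (rule ccontr)
      assume "?b \<noteq> 0"
      \<comment> \<open>Near the minimizer of the quadratic in \<open>t\<close>; the \<open>1\<close> covers the case \<open>?K = 0\<close>.\<close>
      define t where "t = - ?b / (?K + 1)"
      have "t \<noteq> 0" and b: "?b = - (t * (?K + 1))"
        using K \<open>?b \<noteq> 0\<close> by (auto simp: t_def)
      have "2 * t * ?b + t\<^sup>2 * ?K = - (t\<^sup>2 * (?K + 2))"
        unfolding b by (simp add: power2_eq_square algebra_simps)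
      also have "\<dots> < 0"
        using K \<open>t \<noteq> 0\<close> by (simp add: add_nonneg_pos)
      finally show False
        using variation[of t] by linarith
    qed
    then show ?thesis
      by (simp add: l2_inner_commute[of M h g])
  qed
  with g(1) show ?thesis
    by blast
qed

text \<open>
  The adjoint is a choice among the maps with the defining property; Riesz representation of
  \<open>h \<mapsto> T h \<bullet> y\<close> for each \<open>y\<close> shows that there is one to choose.
\<close>

lemma l2_adjoint:
  fixes T :: "('a \<Rightarrow> real) \<Rightarrow> 'y::real_inner"
  assumes T: "l2_bounded_linear M T"
  shows "l2_adjoint M T y \<in> L2 M"
    and "h \<in> L2 M \<Longrightarrow> l2_inner M h (l2_adjoint M T y) = T h \<bullet> y"
proof -
  obtain C where C: "\<And>f. f \<in> L2 M \<Longrightarrow> norm (T f) \<le> C * l2_norm M f"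
    using T unfolding l2_bounded_linear_def by blast
  have "\<exists>g\<in>L2 M. \<forall>h\<in>L2 M. T h \<bullet> y = l2_inner M h g" for y
  proof (rule L2_Riesz_representation)
    fix f assume f: "f \<in> L2 M"
    have "\<bar>T f \<bullet> y\<bar> \<le> norm (T f) * norm y"
      by (rule Cauchy_Schwarz_ineq2)
    also have "\<dots> \<le> (C * l2_norm M f) * norm y"
      by (intro mult_right_mono C f) simp
    finally show "\<bar>T f \<bullet> y\<bar> \<le> (C * norm y) * l2_norm M f"
      by (simp add: algebra_simps)
  qed (use T in \<open>auto simp: l2_bounded_linear_def inner_add_left\<close>)
  then have "\<exists>T'. \<forall>y. T' y \<in> L2 M \<and> (\<forall>h\<in>L2 M. T h \<bullet> y = l2_inner M h (T' y))"
    by metis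
  then have *: "\<forall>y. l2_adjoint M T y \<in> L2 M \<and>
      (\<forall>h\<in>L2 M. T h \<bullet> y = l2_inner M h (l2_adjoint M T y))"
    unfolding l2_adjoint_def by (rule someI_ex)
  show "l2_adjoint M T y \<in> L2 M"
    using * by blast
  show "l2_inner M h (l2_adjoint M T y) = T h \<bullet> y" if "h \<in> L2 M"
    using * that by simp
qed


section \<open>Conjugates and subdifferentials\<close>

lemma l2_Fenchel_Young:
  "u \<in> L2 M \<Longrightarrow> ereal (l2_inner M q u) - H u \<le> l2_conjugate M H q"
  unfolding l2_conjugate_def by (rule SUP_upper)

text \<open>A conjugate is a supremum of affine functions.\<close>

lemma l2_conjugate_convex:
  assumes u: "u \<in> L2 M" and v: "v \<in> L2 M" and t: "0 \<le> t" "t \<le> 1"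
    and bu: "l2_conjugate M H u \<le> ereal b" and cv: "l2_conjugate M H v \<le> ereal c"
  shows "l2_conjugate M H (\<lambda>x. (1 - t) * u x + t * v x) \<le> ereal ((1 - t) * b + t * c)"
  unfolding l2_conjugate_def
proof (rule SUP_least)
  fix q assume q: "q \<in> L2 M"
  have "ereal (l2_inner M u q) - H q \<le> ereal b" "ereal (l2_inner M v q) - H q \<le> ereal c"
    using l2_Fenchel_Young[OF q] bu cv order_trans by blast+
  then show "ereal (l2_inner M (\<lambda>x. (1 - t) * u x + t * v x) q) - H q
      \<le> ereal ((1 - t) * b + t * c)"
  proof (cases "H q")
    case (real r)
    then have "(1 - t) * (l2_inner M u q - r) \<le> (1 - t) * b" "t * (l2_inner M v q - r) \<le> t * c"
      using \<open>ereal (l2_inner M u q) - H q \<le> ereal b\<close> \<open>ereal (l2_inner M v q) - H q \<le> ereal c\<close> t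
      by (auto intro!: mult_left_mono)
    then show ?thesis
      unfolding l2_inner_lincomb_left[OF u v q] using real by (simp add: algebra_simps)
  qed auto
qed

lemma l2_biconjugate_le:
  assumes "u \<in> L2 M" "H u = ereal r"
  shows "l2_conjugate M (l2_conjugate M H) u \<le> H u"
  unfolding l2_conjugate_def[of M "l2_conjugate M H"]
proof (rule SUP_least)
  fix q assume "q \<in> L2 M"
  have "ereal (l2_inner M q u) - H u \<le> l2_conjugate M H q"
    by (rule l2_Fenchel_Young) fact
  then show "ereal (l2_inner M u q) - l2_conjugate M H q \<le> H u"
    using assms(2) by (cases "l2_conjugate M H q") (auto simp: l2_inner_commute[of M u q])
qed

text \<open>
  The subgradient inequality for \<open>p \<in> \<partial>H u\<close> says that the supremum defining \<open>H\<^sup>* p\<close> is attained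
  at \<open>u\<close>, whereas \<open>u\<close> is merely a competitor in the supremum defining \<open>H\<^sup>* q\<close>.
\<close>

lemma l2_subdifferential_conjugateI:
  assumes p: "p \<in> L2 M" and u: "u \<in> L2 M" and Hu: "H u = ereal r"
    and sub: "\<And>v. v \<in> L2 M \<Longrightarrow> ereal (r + l2_inner M p (\<lambda>x. v x - u x)) \<le> H v"
  shows "u \<in> l2_subdifferential M (l2_conjugate M H) p"
proof -
  have "l2_conjugate M H p \<le> ereal (l2_inner M p u - r)"
    unfolding l2_conjugate_def
  proof (rule SUP_least)
    fix v assume v: "v \<in> L2 M"
    have "l2_inner M p (\<lambda>x. v x - u x) = l2_inner M p v - l2_inner M p u"
      using l2_inner_diff_left[OF v u p] by (simp add: l2_inner_commute[of M p])
    then show "ereal (l2_inner M p v) - H v \<le> ereal (l2_inner M p u - r)"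
      using sub[OF v] by (cases "H v") auto
  qed
  then have eq: "l2_conjugate M H p = ereal (l2_inner M p u - r)"
    using l2_Fenchel_Young[OF u, of p H] Hu by (intro antisym) auto
  have "l2_conjugate M H p + ereal (l2_inner M u (\<lambda>x. q x - p x)) \<le> l2_conjugate M H q"
    if q: "q \<in> L2 M" for q
  proof -
    have "l2_inner M u (\<lambda>x. q x - p x) = l2_inner M q u - l2_inner M p u"
      using l2_inner_diff_left[OF q p u] by (simp add: l2_inner_commute[of M u])
    then show ?thesis
      using l2_Fenchel_Young[OF u, of q H] Hu by (simp add: eq)
  qed
  then show ?thesis
    using u by (simp add: l2_subdifferential_def eq)
qed


section \<open>The biconjugate of the control cost\<close>

lemma G0_nonneg:
  assumes "0 \<le> \<alpha>" "0 \<le> \<beta>"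
  shows "0 \<le> G0 M \<alpha> \<beta> d a u"
proof -
  have "0 \<le> (LINT x|M. (\<Prod>i=1..d. abs_pow0 (u x - a i)))"
    by (intro integral_nonneg_AE AE_I2 prod_nonneg) (simp add: abs_pow0_def)
  with assms show ?thesis
    by (simp add: G0_def)
qed

text \<open>
  The lower bound comes from testing the biconjugate with the zero function, at which the
  conjugate of the nonnegative \<open>G0\<close> is at most zero; the upper bound is \<open>G0 u\<close>.
\<close>

lemma G_finite_on_admissible:
  assumes "0 \<le> \<alpha>" "0 \<le> \<beta>" "u \<in> admissible M d a"
  obtains r where "G M \<alpha> \<beta> d a u = ereal r"
proof -
  have zero: "(\<lambda>_. 0) \<in> L2 M"
    by (simp add: L2_def)
  have "l2_conjugate M (G0 M \<alpha> \<beta> d a) (\<lambda>_. 0) \<le> 0"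
    unfolding l2_conjugate_def
    using G0_nonneg[OF assms(1,2), of M d a]
    by (intro SUP_least) (simp add: l2_inner_def ereal_minus_le_iff zero_ereal_def[symmetric])
  then have "0 \<le> ereal (l2_inner M u (\<lambda>_. 0)) - l2_conjugate M (G0 M \<alpha> \<beta> d a) (\<lambda>_. 0)"
    by (simp add: l2_inner_def zero_ereal_def[symmetric])
  then have "0 \<le> G M \<alpha> \<beta> d a u"
    unfolding G_def using l2_Fenchel_Young[OF zero] order_trans by blast
  moreover
  obtain c where "G0 M \<alpha> \<beta> d a u = ereal c"
    using assms(3) by (simp add: G0_def)
  then have "G M \<alpha> \<beta> d a u \<le> ereal c"
    unfolding G_def using assms(3) l2_biconjugate_le[of u M "G0 M \<alpha> \<beta> d a" c]
    by (simp add: admissible_def)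
  ultimately show ?thesis
    using that by (cases "G M \<alpha> \<beta> d a u") auto
qed

text \<open>
  Let \<open>\<pi>\<close> be the pointwise projection of \<open>u\<close> onto \<open>{a 1..a d}\<close>. The normal direction \<open>u - \<pi>\<close>
  separates \<open>u\<close> from the admissible set; testing the biconjugate with its multiples
  \<open>t (u - \<pi>)\<close> gives \<open>G u \<ge> t \<parallel>u - \<pi>\<parallel>\<^sup>2\<close> for all \<open>t \<ge> 0\<close>.
\<close>

lemma G_infinite_off_admissible:
  assumes M: "finite_measure M" and nonneg: "0 \<le> \<alpha>" "0 \<le> \<beta>" and a: "a 1 \<le> a d"
    and u: "u \<in> L2 M" "u \<notin> admissible M d a"
  shows "G M \<alpha> \<beta> d a u = \<infinity>"
proof -
  define \<pi> where "\<pi> x = max (a 1) (min (a d) (u x))" for x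
  let ?n = "\<lambda>x. u x - \<pi> x"
  have [measurable]: "u \<in> borel_measurable M"
    using u(1) by (rule L2_measurable)
  have [measurable]: "\<pi> \<in> borel_measurable M"
    unfolding \<pi>_def by measurable
  have \<pi>: "\<pi> x \<in> {a 1..a d}" for x
    using a by (auto simp: \<pi>_def)
  have \<pi>_L2: "\<pi> \<in> L2 M"
  proof -
    have "integrable M (\<lambda>x. (\<pi> x)\<^sup>2)"
    proof (rule finite_measure.integrable_const_bound[OF M])
      show "AE x in M. norm ((\<pi> x)\<^sup>2) \<le> (\<bar>a 1\<bar> + \<bar>a d\<bar>)\<^sup>2"
      proof (rule AE_I2)
        fix x
        have "\<bar>\<pi> x\<bar> \<le> \<bar>a 1\<bar> + \<bar>a d\<bar>"
          using \<pi>[of x] by auto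
        then show "norm ((\<pi> x)\<^sup>2) \<le> (\<bar>a 1\<bar> + \<bar>a d\<bar>)\<^sup>2"
          by (simp add: abs_le_square_iff[symmetric])
      qed
    qed simp
    then show ?thesis
      by (simp add: L2_def)
  qed
  have n: "?n \<in> L2 M"
    by (intro L2_diff u \<pi>_L2)
  have normal: "l2_inner M ?n v \<le> l2_inner M ?n \<pi>" if v: "v \<in> admissible M d a" for v
    unfolding l2_inner_def
  proof (rule integral_mono_AE)
    show "integrable M (\<lambda>x. ?n x * v x)" "integrable M (\<lambda>x. ?n x * \<pi> x)"
      using v by (auto intro!: integrable_mult_L2 n \<pi>_L2 simp: admissible_def)
    have "AE x in M. v x \<in> {a 1..a d}"
      using v by (simp add: admissible_def)
    then show "AE x in M. ?n x * v x \<le> ?n x * \<pi> x"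
    proof eventually_elim
      case (elim x)
      then show ?case
        using a by (auto simp: \<pi>_def max_def min_def mult_left_mono mult_left_mono_neg)
    qed
  qed
  let ?K = "l2_inner M ?n ?n"
  have K: "0 < ?K"
  proof (rule ccontr)
    assume "\<not> 0 < ?K"
    then have "?K = 0"
      using l2_inner_self_nonneg[of M ?n] by linarith
    then have "(LINT x|M. (?n x)\<^sup>2) = 0"
      by (simp add: l2_inner_def power2_eq_square)
    then have "AE x in M. (?n x)\<^sup>2 = 0"
      using n by (subst (asm) integral_nonneg_eq_0_iff_AE) (auto simp: L2_def)
    then have "AE x in M. u x \<in> {a 1..a d}"
    proof eventually_elim
      case (elim x)
      then show ?case
        using \<pi>[of x] by simp
    qed
    then show False
      using u by (simp add: admissible_def)
  qed
  have lower: "ereal (t * ?K) \<le> G M \<alpha> \<beta> d a u" if t: "0 \<le> t" for t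
  proof -
    let ?q = "\<lambda>x. t * ?n x"
    have "l2_conjugate M (G0 M \<alpha> \<beta> d a) ?q \<le> ereal (t * l2_inner M ?n \<pi>)"
      unfolding l2_conjugate_def
    proof (rule SUP_least)
      fix v assume "v \<in> L2 M"
      show "ereal (l2_inner M ?q v) - G0 M \<alpha> \<beta> d a v \<le> ereal (t * l2_inner M ?n \<pi>)"
      proof (cases "v \<in> admissible M d a")
        case True
        then have "l2_inner M ?q v \<le> t * l2_inner M ?n \<pi>"
          using t by (simp add: l2_inner_cmult_left mult_left_mono normal)
        then show ?thesis
          using G0_nonneg[OF nonneg, of M d a v] by (cases "G0 M \<alpha> \<beta> d a v") auto
      qed (simp add: G0_def)
    qed
    moreover have "ereal (l2_inner M u ?q) - l2_conjugate M (G0 M \<alpha> \<beta> d a) ?q \<le> G M \<alpha> \<beta> d a u"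
      unfolding G_def by (intro l2_Fenchel_Young L2_cmult n)
    moreover have "l2_inner M u ?q - t * l2_inner M ?n \<pi> = t * ?K"
    proof -
      have "l2_inner M u ?q = t * l2_inner M u ?n"
        by (simp only: l2_inner_commute[of M u] l2_inner_cmult_left)
      moreover have "?K = l2_inner M u ?n - l2_inner M ?n \<pi>"
        using l2_inner_diff_left[OF u(1) \<pi>_L2 n] by (simp only: l2_inner_commute[of M \<pi>])
      ultimately show ?thesis
        by (simp only: right_diff_distrib)
    qed
    ultimately show ?thesis
      by (cases "l2_conjugate M (G0 M \<alpha> \<beta> d a) ?q"; cases "G M \<alpha> \<beta> d a u") auto
  qed
  show ?thesis
  proof (rule ereal_top)
    fix B :: real
    have "ereal B \<le> ereal (max 0 (B / ?K) * ?K)"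
      using K by (simp add: max_def field_simps)
    also have "\<dots> \<le> G M \<alpha> \<beta> d a u"
      by (rule lower) simp
    finally show "ereal B \<le> G M \<alpha> \<beta> d a u" .
  qed
qed


section \<open>The first-order condition\<close>

lemma admissible_convex:
  assumes u: "u \<in> admissible M d a" and v: "v \<in> admissible M d a" and t: "0 \<le> t" "t \<le> 1"
  shows "(\<lambda>x. (1 - t) * u x + t * v x) \<in> admissible M d a"
proof -
  have "AE x in M. u x \<in> {a 1..a d}" "AE x in M. v x \<in> {a 1..a d}"
    using u v by (auto simp: admissible_def)
  then have "AE x in M. (1 - t) * u x + t * v x \<in> {a 1..a d}"
  proof eventually_elim
    case (elim x)
    have "(1 - t) *\<^sub>R u x + t *\<^sub>R v x \<in> {a 1..a d}"
      using t elim by (intro convexD) auto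
    then show ?case
      by simp
  qed
  then show ?thesis
    using u v by (auto simp: admissible_def intro: L2_lincomb)
qed

lemma has_l2_derivative_directional:
  fixes S :: "('a \<Rightarrow> real) \<Rightarrow> 'y::real_normed_vector"
  assumes D: "has_l2_derivative M U S D u" and L2: "u \<in> L2 M" "v \<in> L2 M"
    and U: "\<And>t. 0 < t \<Longrightarrow> t < 1 \<Longrightarrow> (\<lambda>x. (1 - t) * u x + t * v x) \<in> U"
  shows "((\<lambda>t. (S (\<lambda>x. (1 - t) * u x + t * v x) - S u) /\<^sub>R t) \<longlongrightarrow> D (\<lambda>x. v x - u x))
    (at_right 0)"
proof -
  define h where "h = (\<lambda>x. v x - u x)"
  define w where "w t = (\<lambda>x. (1 - t) * u x + t * v x)" for t
  have h: "h \<in> L2 M"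
    unfolding h_def by (intro L2_diff L2)
  have wh: "(\<lambda>x. w t x - u x) = (\<lambda>x. t * h x)" for t
    by (auto simp: w_def h_def algebra_simps)
  let ?N = "l2_norm M h"
  have N: "0 \<le> ?N"
    by (rule l2_norm_nonneg)
  have "\<forall>\<^sub>F t in at_right 0. dist ((S (w t) - S u) /\<^sub>R t) (D h) < e" if e: "0 < e" for e :: real
  proof -
    have "0 < e / (?N + 1)"
      using e N by simp
    then obtain \<delta> where \<delta>: "0 < \<delta>" and rem: "\<And>y. y \<in> U \<Longrightarrow> l2_norm M (\<lambda>x. y x - u x) < \<delta> \<Longrightarrow>
        norm (S y - S u - D (\<lambda>x. y x - u x)) \<le> e / (?N + 1) * l2_norm M (\<lambda>x. y x - u x)"
      using D unfolding has_l2_derivative_def by blast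
    have "\<forall>\<^sub>F t in at_right 0. t \<in> {0<..<min 1 (\<delta> / (?N + 1))}"
      using \<delta> N by (intro eventually_at_right_real) simp
    then show ?thesis
    proof eventually_elim
      case (elim t)
      then have t: "0 < t" "t < 1" "t * (?N + 1) < \<delta>"
        using N by (auto simp: pos_less_divide_eq)
      have small: "l2_norm M (\<lambda>x. w t x - u x) = t * ?N"
        using t by (simp add: wh l2_norm_cmult)
      have "t * ?N < \<delta>"
        using t by (simp add: algebra_simps)
      then have "norm (S (w t) - S u - D (\<lambda>x. w t x - u x)) \<le> e / (?N + 1) * (t * ?N)"
        using rem[of "w t"] U[OF t(1,2)] by (simp add: small w_def[symmetric])
      moreover have "D (\<lambda>x. w t x - u x) = t *\<^sub>R D h"
        using D h by (simp add: wh has_l2_derivative_def l2_bounded_linear_def)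
      moreover have "(S (w t) - S u) /\<^sub>R t - D h = (S (w t) - S u - t *\<^sub>R D h) /\<^sub>R t"
        using t by (simp add: algebra_simps)
      ultimately have "norm ((S (w t) - S u) /\<^sub>R t - D h) \<le> (e / (?N + 1) * (t * ?N)) / t"
        using t by (simp add: divide_inverse mult.commute mult_right_mono)
      also have "\<dots> = e * (?N / (?N + 1))"
        using t(1) by simp
      also have "\<dots> < e * 1"
        using e N by (intro mult_strict_left_mono) (auto simp: divide_less_eq)
      finally show ?case
        by (simp add: dist_norm)
    qed
  qed
  then show ?thesis
    unfolding tendsto_iff w_def h_def by blast
qed

text \<open>
  Along the segment from \<open>u\<close> to \<open>v\<close>, minimality bounds the increase of the smooth part from
  below by the decrease of \<open>H\<close>, and convexity of \<open>H\<close> makes that decrease at most linear in the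
  step. Dividing by the step and letting it tend to zero leaves the directional derivative.
\<close>

lemma local_minimizer_variational_inequality:
  fixes S :: "('a \<Rightarrow> real) \<Rightarrow> 'y::real_inner"
  assumes min: "l2_local_minimizer M (\<lambda>u. ereal (tracking S z u) + l2_conjugate M H u) u"
    and D: "has_l2_derivative M U S D u"
    and L2: "v \<in> L2 M"
    and U: "\<And>t. 0 < t \<Longrightarrow> t < 1 \<Longrightarrow> (\<lambda>x. (1 - t) * u x + t * v x) \<in> U"
    and b: "l2_conjugate M H u = ereal b" and c: "l2_conjugate M H v = ereal c"
  shows "b - D (\<lambda>x. v x - u x) \<bullet> (S u - z) \<le> c"
proof -
  have u: "u \<in> L2 M"
    using min by (simp add: l2_local_minimizer_def)
  obtain r where r: "0 < r" and le: "\<And>y. y \<in> L2 M \<Longrightarrow> l2_norm M (\<lambda>x. y x - u x) < r \<Longrightarrow>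
      ereal (tracking S z u) + l2_conjugate M H u \<le> ereal (tracking S z y) + l2_conjugate M H y"
    using min unfolding l2_local_minimizer_def by blast
  define w where "w t = (\<lambda>x. (1 - t) * u x + t * v x)" for t
  define Q where "Q t = (S (w t) - S u) /\<^sub>R t" for t
  let ?N = "l2_norm M (\<lambda>x. v x - u x)"
  have N: "0 \<le> ?N"
    by (rule l2_norm_nonneg)
  have "\<forall>\<^sub>F t in at_right 0. t \<in> {0<..<min 1 (r / (?N + 1))}"
    using r N by (intro eventually_at_right_real) simp
  then have "\<forall>\<^sub>F t in at_right 0. 0 \<le> c - b + (S u - z) \<bullet> Q t + t / 2 * (norm (Q t))\<^sup>2"
  proof eventually_elim
    case (elim t)
    then have t: "0 < t" "t < 1" "t * (?N + 1) < r"
      using N by (auto simp: pos_less_divide_eq)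
    have "(\<lambda>x. w t x - u x) = (\<lambda>x. t * (v x - u x))"
      by (auto simp: w_def algebra_simps)
    then have "l2_norm M (\<lambda>x. w t x - u x) = t * ?N"
      using t by (simp add: l2_norm_cmult)
    then have "l2_norm M (\<lambda>x. w t x - u x) < r"
      using t(1,3) by (simp add: distrib_left)
    then have "ereal (tracking S z u) + ereal b \<le> ereal (tracking S z (w t)) + l2_conjugate M H (w t)"
      using le[of "w t"] u L2 by (simp add: w_def L2_lincomb b)
    also have "\<dots> \<le> ereal (tracking S z (w t)) + ereal ((1 - t) * b + t * c)"
      unfolding w_def using t u L2 b c by (intro add_left_mono l2_conjugate_convex) auto
    finally have "0 \<le> tracking S z (w t) - tracking S z u + t * (c - b)"
      by (simp add: algebra_simps)
    moreover have "tracking S z (w t) - tracking S z u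
        = t * ((S u - z) \<bullet> Q t + t / 2 * (norm (Q t))\<^sup>2)"
    proof -
      define y where "y = S u - z"
      have eq: "S (w t) - z = y + t *\<^sub>R Q t"
        using t by (simp add: Q_def y_def)
      have "(norm (y + t *\<^sub>R Q t))\<^sup>2 = (norm y)\<^sup>2 + 2 * t * (y \<bullet> Q t) + t\<^sup>2 * (norm (Q t))\<^sup>2"
        unfolding power2_norm_eq_inner
        by (simp add: inner_add_left inner_add_right inner_commute[of "Q t" y] power2_eq_square
            algebra_simps)
      then show ?thesis
        unfolding tracking_def eq y_def[symmetric] by (simp add: power2_eq_square algebra_simps)
    qed
    ultimately have "0 \<le> t * (c - b + (S u - z) \<bullet> Q t + t / 2 * (norm (Q t))\<^sup>2)"
      by (simp add: algebra_simps)
    then show ?case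
      using t(1) by (simp add: zero_le_mult_iff)
  qed
  moreover have Q: "(Q \<longlongrightarrow> D (\<lambda>x. v x - u x)) (at_right 0)"
    unfolding Q_def w_def using has_l2_derivative_directional[OF D u L2 U] by simp
  moreover have "((\<lambda>t. c - b + (S u - z) \<bullet> Q t + t / 2 * (norm (Q t))\<^sup>2)
      \<longlongrightarrow> c - b + (S u - z) \<bullet> D (\<lambda>x. v x - u x) + 0 / 2 * (norm (D (\<lambda>x. v x - u x)))\<^sup>2) (at_right 0)"
    by (intro tendsto_intros Q) auto
  ultimately have "0 \<le> c - b + (S u - z) \<bullet> D (\<lambda>x. v x - u x)
      + 0 / 2 * (norm (D (\<lambda>x. v x - u x)))\<^sup>2"
    by (intro tendsto_lowerbound) auto
  then show ?thesis
    by (simp add: inner_commute)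
qed

theorem proposition2p2:
  fixes \<Omega> :: "(real ^ 'n) set"
    and d :: nat and a :: "nat \<Rightarrow> real" and \<alpha> \<beta> :: real
    and S :: "(real ^ 'n \<Rightarrow> real) \<Rightarrow> 'y :: {real_inner, complete_space}" and z :: 'y
    and S' :: "(real ^ 'n \<Rightarrow> real) \<Rightarrow> (real ^ 'n \<Rightarrow> real) \<Rightarrow> 'y"
    and S'' :: "(real ^ 'n \<Rightarrow> real) \<Rightarrow> (real ^ 'n \<Rightarrow> real) \<Rightarrow> (real ^ 'n \<Rightarrow> real) \<Rightarrow> 'y"
    and ubar :: "real ^ 'n \<Rightarrow> real"
  assumes "open \<Omega>" "connected \<Omega>" "\<Omega> \<noteq> {}" "bounded \<Omega>"
    and "d \<ge> 2" "strict_mono_on {1..d} a"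
    and "\<alpha> > 0" "\<beta> \<ge> 0"
    and "weak_to_weak_continuous_on (lebesgue_on \<Omega>) (admissible (lebesgue_on \<Omega>) d a) S"
    and "\<forall>u \<in> admissible (lebesgue_on \<Omega>) d a.
           has_l2_derivative (lebesgue_on \<Omega>) (admissible (lebesgue_on \<Omega>) d a) S (S' u) u"
    and "\<forall>u \<in> admissible (lebesgue_on \<Omega>) d a.
           has_l2_derivative_op (lebesgue_on \<Omega>) (admissible (lebesgue_on \<Omega>) d a) S' (S'' u) u"
    and "ubar \<in> admissible (lebesgue_on \<Omega>) d a"
    and "l2_local_minimizer (lebesgue_on \<Omega>)
           (\<lambda>u. ereal (tracking S z u) + G (lebesgue_on \<Omega>) \<alpha> \<beta> d a u) ubar"
  shows "\<exists>pbar \<in> L2 (lebesgue_on \<Omega>).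
           (AE x in lebesgue_on \<Omega>.
              - pbar x = l2_adjoint (lebesgue_on \<Omega>) (S' ubar) (S ubar - z) x) \<and>
           ubar \<in> l2_subdifferential (lebesgue_on \<Omega>)
                    (l2_conjugate (lebesgue_on \<Omega>) (G (lebesgue_on \<Omega>) \<alpha> \<beta> d a)) pbar"
proof -
  let ?M = "lebesgue_on \<Omega>"
  let ?U = "admissible ?M d a"
  let ?G = "G ?M \<alpha> \<beta> d a"
  have M: "finite_measure ?M"
    using assms(1,4) by (intro finite_measure_lebesgue_on lmeasurable_open)
  have a: "a 1 \<le> a d"
    using assms(5) strict_mono_onD[OF assms(6), of 1 d] by simp
  have \<alpha>: "0 \<le> \<alpha>" and \<beta>: "0 \<le> \<beta>"
    using assms(7,8) by auto
  have D: "has_l2_derivative ?M ?U S (S' ubar) ubar"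
    using assms(10,12) by blast
  then have bl: "l2_bounded_linear ?M (S' ubar)"
    by (simp add: has_l2_derivative_def)
  have ubar: "ubar \<in> L2 ?M"
    using assms(12) by (simp add: admissible_def)
  obtain b where b: "?G ubar = ereal b"
    using G_finite_on_admissible[OF \<alpha> \<beta> assms(12)] by blast
  define p where "p = (\<lambda>x. - 1 * l2_adjoint ?M (S' ubar) (S ubar - z) x)"
  have p: "p \<in> L2 ?M"
    unfolding p_def by (intro L2_cmult l2_adjoint bl)
  have sub: "ereal (b + l2_inner ?M p (\<lambda>x. v x - ubar x)) \<le> ?G v" if v: "v \<in> L2 ?M" for v
  proof (cases "v \<in> ?U")
    case True
    obtain c where c: "?G v = ereal c"
      using G_finite_on_admissible[OF \<alpha> \<beta> True] by blast
    have "b - S' ubar (\<lambda>x. v x - ubar x) \<bullet> (S ubar - z) \<le> c"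
      using local_minimizer_variational_inequality[OF assms(13)[unfolded G_def] D v _
          b[unfolded G_def] c[unfolded G_def]]
        admissible_convex[OF assms(12) True] by simp
    moreover have "l2_inner ?M p (\<lambda>x. v x - ubar x) = - (S' ubar (\<lambda>x. v x - ubar x) \<bullet> (S ubar - z))"
      unfolding p_def l2_inner_cmult_left
      using l2_adjoint(2)[OF bl L2_diff[OF v ubar], of "S ubar - z"]
      by (simp add: l2_inner_commute[of ?M "l2_adjoint ?M (S' ubar) (S ubar - z)"])
    ultimately show ?thesis
      by (simp add: c)
  next
    case False
    then show ?thesis
      using G_infinite_off_admissible[OF M \<alpha> \<beta> a v] by simp
  qed
  show ?thesis
  proof (intro bexI conjI)
    show "ubar \<in> l2_subdifferential ?M (l2_conjugate ?M ?G) p"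
      using p ubar b sub by (rule l2_subdifferential_conjugateI)
    show "AE x in ?M. - p x = l2_adjoint ?M (S' ubar) (S ubar - z) x"
      by (simp add: p_def)
  qed (rule p)
qed

end
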